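(* Let $E$ be a Dedekind complete lattice-ordered field (which is also a Riesz space with the same addition and order) with a conditional expectation $T$ and a weak order unit $e$ such that $T(e)=e$. Suppose $B_1,\dots,B_n$ are $n$ mutually disjoint nonempty projection bands in $E$ such that $E=B_1\oplus B_2\oplus\cdots\oplus B_n$, and let $P_{B_i}$ be the band projection onto $B_i$. Then for any projection band $D$ in $E$, with associated band projection $P_D$, and for every $f\in E$ such that $TP_{B_i}(f)\neq 0$ for all $1\leq i\leq n$, $$TP_D(f)=\sum_{i=1}^n \bigl(P_{D\mid B_i}(f)\bigr)\bigl(TP_{B_i}(f)\bigr),$$ where $P_{D\mid B_i}$ denotes the conditional probability of $D$ given $B_i$ with respect to $T$.
   Context: Riesz space notions. A Riesz space is a real ordered vector space that is a lattice; $|x|=x\vee(-x)$. It is Dedekind complete if every nonempty subset bounded from above has a supremum. A Riesz subspace is a vector subspace closed under the lattice operations. An ideal is a vector subspace $Y$ such that $|x|\leq|y|$, $y\in Y$ imply $x\in Y$. A net $(x_\alpha)$ order-converges to $x$ if there is a net $(y_\alpha)$ with the same index set with $|x_\alpha-x|\leq y_\alpha\downarrow0$. A band is an order-closed ideal. The disjoint complement of $A$ is $A^d=\{x\mid |x|\wedge|y|=0\ \forall y\in A\}$; two bands are disjoint if $|x|\wedge|y|=0$ for all $x$ in one and $y$ in the other. A band $B$ in $X$ is a projection band if $X=B\oplus B^d$, and its band projection $P_B:X\to X$ sends $x=x_1+x_2$ ($x_1\in B$, $x_2\in B^d$) to $x_1$. A weak order unit is an element $e>0$ such that the band generated by $e$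 is the whole space. Lattice-ordered field. A field $F$ with a partial order $\leq$ is a partially ordered field if (a) $x\leq y$ implies $x+z\leq y+z$ for all $z$; (b) $x>y$ and $z>0$ imply $xz>yz$; (c) $1>0$, where $1$ is the multiplicative identity. It is a lattice-ordered field if in addition its additive group is a lattice-ordered group, i.e. the order is a lattice order. Here $E$ carries both a lattice-ordered field structure and a Riesz space structure, with the same addition and the same order; products and inverses of elements of $E$ are taken in the field $E$. Conditional expectation. A conditional expectation on a Riesz space $X$ with a weak order unit is a linear operator $T:X\to X$ that is a projection ($T^2=T$), positive ($x\geq0$ implies $T(x)\geq0$) and order-continuous ($x_\alpha$ order-converging to $0$ implies $T(x_\alpha)$ order-converges to $0$), whose range $R(T)$ is a Dedekind complete Riesz subspace of $X$, and such that $T(e)$ is a weak order unit of $X$ for every weak order unit $e$ of $X$. Conditional probability. For projection bands $C_1,C_2$ of $E$ with $C_1\cap C_2\neq\emptyset$ (automatic, since both contain $0$), the conditional probability of $C_1$ given $C_2$ with respect to $T$ is defined by $$P_{C_1\mid C_2}(f)=[TP_{C_2}P_{C_1}(f)]\,[TP_{C_2}(f)]^{-1}$$ for those $f\in E$ with $TP_{C_2}(f)\neq0$. *)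

theory Defs
  imports Complex_Main "HOL-Library.Lattice_Algebras" "HOL-Library.Lub_Glb" "HOL-Library.FuncSet"
begin

(* Here abs x = sup x (-x), by the axiom of lattice_ab_group_add_abs. *)
class riesz_space = ordered_real_vector + lattice_ab_group_add_abs

class partially_ordered_field = field + ordered_ab_group_add +
  assumes mult_strict_right_mono_pof: "y < x \<Longrightarrow> 0 < z \<Longrightarrow> y * z < x * z"
    and one_pos_pof: "0 < 1"

(* No compatibility between real scalars and the field multiplication is imposed when this
   class is combined with riesz_space: only addition and order are shared. *)
class lattice_ordered_field = partially_ordered_field + lattice_ab_group_add

(* Suprema are taken inside S, i.e. S is regarded as a Riesz space of its own. *)
definition dedekind_complete_on :: "'a::riesz_space set \<Rightarrow> bool" where
  "dedekind_complete_on S \<longleftrightarrow>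
     (\<forall>A. A \<subseteq> S \<and> A \<noteq> {} \<and> (\<exists>u. isUb S A u) \<longrightarrow> (\<exists>s. isLub S A s))"

definition riesz_subspace :: "'a::riesz_space set \<Rightarrow> bool" where
  "riesz_subspace S \<longleftrightarrow> subspace S \<and> (\<forall>x\<in>S. \<forall>y\<in>S. sup x y \<in> S \<and> inf x y \<in> S)"

definition riesz_ideal :: "'a::riesz_space set \<Rightarrow> bool" where
  "riesz_ideal Y \<longleftrightarrow> subspace Y \<and> (\<forall>x y. y \<in> Y \<and> \<bar>x\<bar> \<le> \<bar>y\<bar> \<longrightarrow> x \<in> Y)"

definition directed_preorder :: "'i set \<Rightarrow> ('i \<Rightarrow> 'i \<Rightarrow> bool) \<Rightarrow> bool" where
  "directed_preorder I le \<longleftrightarrow> I \<noteq> {} \<and> reflp_on I le \<and> transp_on I le \<and>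
     (\<forall>i\<in>I. \<forall>j\<in>I. \<exists>k\<in>I. le i k \<and> le j k)"

definition decreases_to_zero :: "'i set \<Rightarrow> ('i \<Rightarrow> 'i \<Rightarrow> bool) \<Rightarrow> ('i \<Rightarrow> 'a::riesz_space) \<Rightarrow> bool" where
  "decreases_to_zero I le y \<longleftrightarrow>
     (\<forall>i\<in>I. \<forall>j\<in>I. le i j \<longrightarrow> y j \<le> y i) \<and> isGlb UNIV (y ` I) 0"

definition order_converges ::
    "'i set \<Rightarrow> ('i \<Rightarrow> 'i \<Rightarrow> bool) \<Rightarrow> ('i \<Rightarrow> 'a::riesz_space) \<Rightarrow> 'a \<Rightarrow> bool" where
  "order_converges I le x l \<longleftrightarrow> directed_preorder I le \<and>
     (\<exists>y. decreases_to_zero I le y \<and> (\<forall>i\<in>I. \<bar>x i - l\<bar> \<le> y i))"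

(* HOL cannot quantify over index types inside a formula. Nets indexed by subsets of 'a \<times> 'a
   suffice: a net (x_i) dominated by (y_i) can be reindexed by the pairs (x_i, y_i); see
   order_closedD and order_continuousD below, which recover arbitrary index types. *)
definition order_closed :: "'a::riesz_space set \<Rightarrow> bool" where
  "order_closed S \<longleftrightarrow>
     (\<forall>(I :: ('a \<times> 'a) set) le x l. order_converges I le x l \<and> (\<forall>i\<in>I. x i \<in> S) \<longrightarrow> l \<in> S)"

definition order_continuous :: "('a::riesz_space \<Rightarrow> 'a) \<Rightarrow> bool" where
  "order_continuous T \<longleftrightarrow>
     (\<forall>(I :: ('a \<times> 'a) set) le x. order_converges I le x 0 \<longrightarrow> order_converges I le (\<lambda>i. T (x i)) 0)"

lemma order_converges_reindex:
  fixes x :: "'i \<Rightarrow> 'a::riesz_space"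
  assumes dir: "directed_preorder I le" and dec: "decreases_to_zero I le y"
    and dom: "\<forall>i\<in>I. \<bar>x i - l\<bar> \<le> y i"
  shows "order_converges ((\<lambda>i. (x i, y i)) ` I) (\<lambda>p q. snd q \<le> snd p) fst l"
proof -
  let ?J = "(\<lambda>i. (x i, y i)) ` I"
  let ?le = "\<lambda>p q :: 'a \<times> 'a. snd q \<le> snd p"
  have "\<exists>r\<in>?J. ?le p r \<and> ?le q r" if pq: "p \<in> ?J" "q \<in> ?J" for p q
  proof -
    obtain i j where ij: "i \<in> I" "j \<in> I" "p = (x i, y i)" "q = (x j, y j)"
      using pq by blast
    then obtain k where k: "k \<in> I" "le i k" "le j k"
      using dir unfolding directed_preorder_def by blast
    then have "y k \<le> y i" "y k \<le> y j"
      using dec ij unfolding decreases_to_zero_def by blast+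
    then show ?thesis
      using k(1) ij by (intro bexI[of _ "(x k, y k)"]) simp_all
  qed
  moreover have "?J \<noteq> {}"
    using dir unfolding directed_preorder_def by blast
  moreover have "reflp_on ?J ?le" "transp_on ?J ?le"
    by (rule reflp_onI, rule order_refl) (rule transp_onI, erule (1) order_trans[rotated])
  ultimately have "directed_preorder ?J ?le"
    unfolding directed_preorder_def by blast
  moreover have "decreases_to_zero ?J ?le snd"
    using dec unfolding decreases_to_zero_def image_image snd_conv by blast
  moreover have "\<forall>p\<in>?J. \<bar>fst p - l\<bar> \<le> snd p"
    using dom by (simp only: ball_simps fst_conv snd_conv)
  ultimately show ?thesis
    unfolding order_converges_def by blast
qed

lemma order_closedD:
  fixes x :: "'i \<Rightarrow> 'a::riesz_space"
  assumes "order_closed S" and "order_converges I le x l" and "\<forall>i\<in>I. x i \<in> S"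
  shows "l \<in> S"
proof -
  obtain y where "directed_preorder I le" "decreases_to_zero I le y" "\<forall>i\<in>I. \<bar>x i - l\<bar> \<le> y i"
    using assms(2) unfolding order_converges_def by blast
  note conv = order_converges_reindex[OF this]
  have "\<forall>p\<in>(\<lambda>i. (x i, y i)) ` I. fst p \<in> S"
    using assms(3) by (simp only: ball_simps fst_conv)
  with conv show ?thesis
    using assms(1)[unfolded order_closed_def, rule_format, OF conjI] by blast
qed

lemma order_continuousD:
  fixes x :: "'i \<Rightarrow> 'a::riesz_space"
  assumes "order_continuous T" and "order_converges I le x 0"
  shows "order_converges I le (\<lambda>i. T (x i)) 0"
proof -
  obtain y where y: "directed_preorder I le" "decreases_to_zero I le y" "\<forall>i\<in>I. \<bar>x i - 0\<bar> \<le> y i"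
    using assms(2) unfolding order_converges_def by blast
  let ?J = "(\<lambda>i. (x i, y i)) ` I"
  let ?le = "\<lambda>p q :: 'a \<times> 'a. snd q \<le> snd p"
  have "order_converges ?J ?le (\<lambda>p. T (fst p)) 0"
    using assms(1)[unfolded order_continuous_def, rule_format, OF order_converges_reindex[OF y]] .
  then obtain z where z: "decreases_to_zero ?J ?le z" "\<forall>p\<in>?J. \<bar>T (fst p) - 0\<bar> \<le> z p"
    unfolding order_converges_def by blast
  have "z (x j, y j) \<le> z (x i, y i)" if "i \<in> I" "j \<in> I" "le i j" for i j
  proof -
    have "y j \<le> y i"
      using y(2) that unfolding decreases_to_zero_def by blast
    then have "?le (x i, y i) (x j, y j)"
      by simp
    then show ?thesis
      using z(1) that(1,2) unfolding decreases_to_zero_def by blast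
  qed
  moreover have "isGlb UNIV ((\<lambda>i. z (x i, y i)) ` I) 0"
    using z(1) unfolding decreases_to_zero_def image_image by blast
  ultimately have "decreases_to_zero I le (\<lambda>i. z (x i, y i))"
    unfolding decreases_to_zero_def by blast
  moreover have "\<forall>i\<in>I. \<bar>T (x i) - 0\<bar> \<le> z (x i, y i)"
    using z(2) by (simp only: ball_simps fst_conv)
  ultimately show ?thesis
    unfolding order_converges_def using y(1) by blast
qed

definition band :: "'a::riesz_space set \<Rightarrow> bool" where
  "band B \<longleftrightarrow> riesz_ideal B \<and> order_closed B"

definition band_generated :: "'a::riesz_space set \<Rightarrow> 'a set" where
  "band_generated A = \<Inter>{B. band B \<and> A \<subseteq> B}"

definition weak_order_unit :: "'a::riesz_space \<Rightarrow> bool" where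
  "weak_order_unit e \<longleftrightarrow> 0 < e \<and> band_generated {e} = UNIV"

definition disjoint_complement :: "'a::riesz_space set \<Rightarrow> 'a set" where
  "disjoint_complement A = {x. \<forall>y\<in>A. inf \<bar>x\<bar> \<bar>y\<bar> = 0}"

definition disjoint_bands :: "'a::riesz_space set \<Rightarrow> 'a set \<Rightarrow> bool" where
  "disjoint_bands B C \<longleftrightarrow> (\<forall>x\<in>B. \<forall>y\<in>C. inf \<bar>x\<bar> \<bar>y\<bar> = 0)"

definition projection_band :: "'a::riesz_space set \<Rightarrow> bool" where
  "projection_band B \<longleftrightarrow> band B \<and> (\<forall>x. \<exists>!p. p \<in> B \<times> disjoint_complement B \<and> x = fst p + snd p)"

(* Meaningful only when B is a projection band. *)
definition band_projection :: "'a::riesz_space set \<Rightarrow> 'a \<Rightarrow> 'a" where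
  "band_projection B x = fst (THE p. p \<in> B \<times> disjoint_complement B \<and> x = fst p + snd p)"

(* The whole space is the internal direct sum of the family (B i), i \<in> I. *)
definition is_direct_sum :: "'i set \<Rightarrow> ('i \<Rightarrow> 'a::riesz_space set) \<Rightarrow> bool" where
  "is_direct_sum I B \<longleftrightarrow> (\<forall>x. \<exists>!c. c \<in> Pi\<^sub>E I B \<and> x = (\<Sum>i\<in>I. c i))"

definition conditional_expectation :: "('a::riesz_space \<Rightarrow> 'a) \<Rightarrow> bool" where
  "conditional_expectation T \<longleftrightarrow>
     linear T \<and> T \<circ> T = T \<and> (\<forall>x. 0 \<le> x \<longrightarrow> 0 \<le> T x) \<and> order_continuous T \<and>
     riesz_subspace (range T) \<and> dedekind_complete_on (range T) \<and>
     (\<forall>e. weak_order_unit e \<longrightarrow> weak_order_unit (T e))"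

(* The conditional probability of C1 given C2; meaningful only for projection bands C1, C2 and
   those f with T (band_projection C2 f) \<noteq> 0, since inverse 0 = 0 in the library. *)
definition cond_prob ::
    "('a \<Rightarrow> 'a) \<Rightarrow> 'a set \<Rightarrow> 'a set \<Rightarrow> 'a \<Rightarrow> 'a::{lattice_ordered_field, riesz_space}" where
  "cond_prob T C1 C2 f =
     T (band_projection C2 (band_projection C1 f)) * inverse (T (band_projection C2 f))"

end

theory Submission
  imports Defs
begin

text \<open>This is the law of total probability. Because the bands \<open>B i\<close> are mutually
  disjoint and sum to the whole space, their band projections add up to the identity
  (\<open>sum_band_projections\<close>). Apply this to the component of \<open>f\<close> in
  \<open>D\<close> and use additivity of \<open>T\<close>; each summand is then the numerator of a
  conditional probability, and multiplying by the nonzero denominator undoes the division. The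
  lattice work lies in showing that the components outside \<open>B i\<close> sum to an element
  disjoint from \<open>B i\<close>.\<close>

lemma inf_add_le:
  fixes a b c :: "'a::lattice_ab_group_add"
  assumes "0 \<le> a" "0 \<le> b" "0 \<le> c"
  shows "inf (a + b) c \<le> inf a c + inf b c"
proof -
  \<comment> \<open>By distributivity the right-hand side is the infimum of \<open>a + b\<close>,
    \<open>a + c\<close>, \<open>c + b\<close> and \<open>c + c\<close>. The last three dominate
    \<open>c\<close> by positivity.\<close>
  have "inf (a + b) c \<le> a + c" "inf (a + b) c \<le> c + b" "inf (a + b) c \<le> c + c"
    using assms by (auto intro: le_infI2 add_increasing add_increasing2)
  then show ?thesis
    by (simp add: add_inf_distrib_left add_inf_distrib_right)
qed

lemma zero_in_disjoint_complement: "0 \<in> disjoint_complement (A :: 'a::riesz_space set)"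
  by (simp add: disjoint_complement_def inf_absorb1)

text \<open>The triangle inequality reduces this to absolute values, where \<open>inf_add_le\<close>
  applies.\<close>

lemma add_in_disjoint_complement:
  fixes A :: "'a::riesz_space set"
  assumes x: "x \<in> disjoint_complement A" and y: "y \<in> disjoint_complement A"
  shows "x + y \<in> disjoint_complement A"
  unfolding disjoint_complement_def
proof (intro CollectI ballI antisym)
  fix z assume z: "z \<in> A"
  have "inf \<bar>x + y\<bar> \<bar>z\<bar> \<le> inf (\<bar>x\<bar> + \<bar>y\<bar>) \<bar>z\<bar>"
    by (intro inf_mono abs_triangle_ineq order_refl)
  also have "\<dots> \<le> inf \<bar>x\<bar> \<bar>z\<bar> + inf \<bar>y\<bar> \<bar>z\<bar>"
    by (intro inf_add_le abs_ge_zero)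
  also have "\<dots> = 0"
    using x y z by (simp add: disjoint_complement_def)
  finally show "inf \<bar>x + y\<bar> \<bar>z\<bar> \<le> 0" .
  show "0 \<le> inf \<bar>x + y\<bar> \<bar>z\<bar>"
    by simp
qed

lemma sum_in_disjoint_complement:
  fixes A :: "'a::riesz_space set"
  assumes "\<And>i. i \<in> I \<Longrightarrow> c i \<in> disjoint_complement A"
  shows "sum c I \<in> disjoint_complement A"
  using assms
  by (induction I rule: infinite_finite_induct)
    (auto simp: zero_in_disjoint_complement add_in_disjoint_complement)

lemma band_projection_eqI:
  assumes "projection_band B" "p \<in> B" "q \<in> disjoint_complement B"
  shows "band_projection B (p + q) = p"
proof -
  have "\<exists>!r. r \<in> B \<times> disjoint_complement B \<and> p + q = fst r + snd r"
    using assms(1) unfolding projection_band_def by blast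
  then have "(THE r. r \<in> B \<times> disjoint_complement B \<and> p + q = fst r + snd r) = (p, q)"
    using assms(2,3) by (intro the1_equality) auto
  then show ?thesis
    by (simp add: band_projection_def)
qed

text \<open>Splitting off one term of the direct sum decomposition of \<open>x\<close> gives the
  decomposition along \<open>B i\<close> and its disjoint complement, so by uniqueness the
  projection onto \<open>B i\<close> picks out exactly \<open>c i\<close>.\<close>

lemma sum_band_projections:
  fixes B :: "'i \<Rightarrow> 'a::riesz_space set"
  assumes fin: "finite I" and proj: "\<And>i. i \<in> I \<Longrightarrow> projection_band (B i)"
    and disj: "\<And>i j. i \<in> I \<Longrightarrow> j \<in> I \<Longrightarrow> i \<noteq> j \<Longrightarrow> disjoint_bands (B i) (B j)"
    and dsum: "is_direct_sum I B"
  shows "(\<Sum>i\<in>I. band_projection (B i) x) = x"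
proof -
  obtain c where c: "c \<in> Pi\<^sub>E I B" and x: "x = (\<Sum>i\<in>I. c i)"
    using dsum unfolding is_direct_sum_def by blast
  have "band_projection (B i) x = c i" if i: "i \<in> I" for i
  proof -
    have "c j \<in> disjoint_complement (B i)" if "j \<in> I - {i}" for j
      using disj[of j i] i that c by (auto simp: disjoint_complement_def disjoint_bands_def)
    then have "(\<Sum>j\<in>I - {i}. c j) \<in> disjoint_complement (B i)"
      by (rule sum_in_disjoint_complement)
    moreover have "x = c i + (\<Sum>j\<in>I - {i}. c j)"
      using x sum.remove[OF fin i] by simp
    ultimately show ?thesis
      using band_projection_eqI[OF proj[OF i]] c i by auto
  qed
  then show ?thesis
    using x by simp
qed

theorem theorem4p2:
  fixes T :: "'a \<Rightarrow> 'a::{lattice_ordered_field, riesz_space}"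
    and e f :: 'a
    and n :: nat
    and B :: "nat \<Rightarrow> 'a set"
    and D :: "'a set"
  assumes "dedekind_complete_on (UNIV :: 'a set)"
    and "conditional_expectation T"
    and "weak_order_unit e"
    and "T e = e"
    and "\<And>i. i \<in> {1..n} \<Longrightarrow> projection_band (B i) \<and> B i \<noteq> {}"
    and "\<And>i j. i \<in> {1..n} \<Longrightarrow> j \<in> {1..n} \<Longrightarrow> i \<noteq> j \<Longrightarrow> disjoint_bands (B i) (B j)"
    and "is_direct_sum {1..n} B"
    and "projection_band D"
    and "\<And>i. i \<in> {1..n} \<Longrightarrow> T (band_projection (B i) f) \<noteq> 0"
  shows "T (band_projection D f) =
    (\<Sum>i = 1..n. cond_prob T D (B i) f * T (band_projection (B i) f))"
proof -
  have lin: "linear T"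
    using assms(2) unfolding conditional_expectation_def by blast
  \<comment> \<open>The element decomposed is the projection of \<open>f\<close> onto
    \<open>D\<close>, so the projections already compose in the order used by
    \<open>cond_prob\<close> and need not be commuted.\<close>
  have "T (band_projection D f) = T (\<Sum>i = 1..n. band_projection (B i) (band_projection D f))"
    using assms(5,6,7) by (subst sum_band_projections) auto
  also have "\<dots> = (\<Sum>i = 1..n. T (band_projection (B i) (band_projection D f)))"
    by (rule linear_sum[OF lin])
  also have "\<dots> = (\<Sum>i = 1..n. cond_prob T D (B i) f * T (band_projection (B i) f))"
    \<comment> \<open>Reassociating puts each inverse next to the factor it cancels.\<close>
    using assms(9) by (intro sum.cong) (simp_all add: cond_prob_def mult.assoc)
  finally show ?thesis .
qed

end
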